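(* Fix $t>0$, $x_0\in\mathbb{R}$, $\mu\in\mathbb{R}$ and $\sigma>0$ with $x_0\neq\mu$. For $\theta>0$ let $\gamma_{\theta}$ be the Gaussian probability measure on $\mathbb{R}$ with mean $m_t=x_0e^{-\theta t}+\mu(1-e^{-\theta t})$ and variance $\sigma_t^2=\frac{\sigma^2}{2\theta}\left(1-e^{-2\theta t}\right)$. Define the estimate $T_n^{**}:\mathbb{R}^n\to\mathbb{R}$ $(n\in\mathbb{N})$ by the formula $$T_n^{**}(z_1,\dots,z_n)=-\frac1t\ln\left(\frac{\frac{\sum_{k=1}^n z_k}{n}-\mu}{x_0-\mu}\right).$$ Then for every $\theta>0$, $$\gamma_{\theta}^{\infty}\left(\left\{(z_k)_{k\in\mathbb{N}}\in\mathbb{R}^{\infty}:\ \lim_{n\to\infty}T_n^{**}(z_1,\dots,z_n)=\theta\right\}\right)=1,$$ that is, $T_n^{**}$ is a consistent estimator of the parameter $\theta>0$ (the rate), in the sense of convergence almost everywhere, for the family of probability measures $(\gamma_{\theta}^{\infty})_{\theta>0}$.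
   Context: $\mathbb{R}^\infty=\mathbb{R}^{\mathbb{N}}$ is the space of real sequences $(z_k)_{k\in\mathbb{N}}$, $\mathbb{N}=\{1,2,\dots\}$, with its Borel $\sigma$-algebra; for a Borel probability measure $\gamma$ on $\mathbb{R}$, $\gamma^{\infty}$ denotes the infinite product measure $\gamma\times\gamma\times\cdots$ on $\mathbb{R}^\infty$. Given a family $(\gamma_\vartheta)_{\vartheta\in\Theta}$ of Borel probability measures on $\mathbb{R}$ with $\Theta\subseteq\mathbb{R}$, Borel measurable functions $T_n:\mathbb{R}^n\to\mathbb{R}$ $(n\in\mathbb{N})$ are called a consistent estimator of the parameter $\vartheta$ in the sense of convergence almost everywhere for the family $(\gamma_\vartheta^\infty)_{\vartheta\in\Theta}$ if $\gamma_\vartheta^\infty(\{(z_k)_{k\in\mathbb{N}}:\lim_{n\to\infty}T_n(z_1,\dots,z_n)=\vartheta\})=1$ for each $\vartheta\in\Theta$. (The measure $\gamma_{\theta}$ is the law at time $t$ of the Ornstein-Uhlenbeck process $x_t=x_0e^{-\theta t}+\mu(1-e^{-\theta t})+\sigma\int_0^te^{-\theta(t-s)}dW_s$ with $W$ a Wiener process; the claim only uses $\gamma_{\theta}$ as defined in it.) *)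

theory Defs
  imports "HOL-Probability.Probability"
begin

text \<open>
  Sequences are indexed from 0: the entry \<open>z k\<close> is the mathematical \<open>z\<^sub>k\<^sub>+\<^sub>1\<close>.
  The space of real sequences is the type \<open>nat \<Rightarrow> real\<close>; by \<open>sets_PiM_equal_borel\<close> the product
  sigma-algebra used here is its Borel sigma-algebra. A point of \<open>\<real>\<^sup>n\<close> is an extensional function
  on \<open>{..<n}\<close>.
\<close>

definition infinite_power :: "real measure \<Rightarrow> (nat \<Rightarrow> real) measure" where
  "infinite_power \<gamma> = PiM (UNIV :: nat set) (\<lambda>_. \<gamma>)"

abbreviation borel_Rn :: "nat \<Rightarrow> (nat \<Rightarrow> real) measure" where
  "borel_Rn n \<equiv> PiM {..<n} (\<lambda>_. borel :: real measure)"

definition consistent_estimator_ae ::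
    "real set \<Rightarrow> (real \<Rightarrow> real measure) \<Rightarrow> (nat \<Rightarrow> (nat \<Rightarrow> real) \<Rightarrow> real) \<Rightarrow> bool" where
  "consistent_estimator_ae \<Theta> \<gamma> T \<longleftrightarrow>
     (\<forall>\<theta>\<in>\<Theta>. prob_space (\<gamma> \<theta>) \<and> sets (\<gamma> \<theta>) = sets borel) \<and>
     (\<forall>n\<ge>1. T n \<in> borel_measurable (borel_Rn n)) \<and>
     (\<forall>\<theta>\<in>\<Theta>. measure (infinite_power (\<gamma> \<theta>))
        {z. (\<lambda>n. T n (restrict z {..<n})) \<longlonglongrightarrow> \<theta>} = 1)"

definition ou_mean :: "real \<Rightarrow> real \<Rightarrow> real \<Rightarrow> real \<Rightarrow> real" where
  "ou_mean t x0 \<mu> \<theta> = x0 * exp (- \<theta> * t) + \<mu> * (1 - exp (- \<theta> * t))"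

definition ou_variance :: "real \<Rightarrow> real \<Rightarrow> real \<Rightarrow> real" where
  "ou_variance t \<sigma> \<theta> = \<sigma>\<^sup>2 / (2 * \<theta>) * (1 - exp (- 2 * \<theta> * t))"

text \<open>The second parameter of \<open>normal_density\<close> is the standard deviation.\<close>

definition ou_law :: "real \<Rightarrow> real \<Rightarrow> real \<Rightarrow> real \<Rightarrow> real \<Rightarrow> real measure" where
  "ou_law t x0 \<mu> \<sigma> \<theta> =
     density lborel (\<lambda>x. ennreal (normal_density (ou_mean t x0 \<mu> \<theta>) (sqrt (ou_variance t \<sigma> \<theta>)) x))"

text \<open>
  The formula is only meaningful when the argument of the logarithm is positive, whereas the
  library's real \<open>ln\<close> satisfies \<open>ln (- x) = ln x\<close>. Outside the domain the estimate is set to 0.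
  As 0 is not a positive rate, convergence of the estimate to some \<open>\<theta> > 0\<close> entails that
  the argument of the logarithm is eventually positive.
\<close>

definition rate_estimate :: "real \<Rightarrow> real \<Rightarrow> real \<Rightarrow> nat \<Rightarrow> (nat \<Rightarrow> real) \<Rightarrow> real" where
  "rate_estimate t x0 \<mu> n z =
     (let q = ((\<Sum>k<n. z k) / real n - \<mu>) / (x0 - \<mu>)
      in if q > 0 then - (1 / t) * ln q else 0)"

end

theory Submission
  imports Defs
begin

text \<open>
  The sample mean of \<open>n\<close> independent normal variables is normal, so its centred fourth moment is
  \<open>3\<sigma>\<^sup>4/n\<^sup>2\<close>, which is summable. Hence the fourth powers of the deviations are almost surely summable,
  and the sample means converge almost surely. Since \<open>m\<^sub>t - \<mu> = (x\<^sub>0 - \<mu>) exp (-\<theta>t)\<close>, the estimate is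
  obtained from the sample mean by a map that is continuous at \<open>m\<^sub>t\<close> with value \<open>\<theta>\<close>.
\<close>

text \<open>This takes the place of Chebyshev plus Borel-Cantelli. By monotone convergence the
  series of the \<open>Y n\<close> has a finite integral, so it is finite almost everywhere, and the
  terms of a convergent series tend to 0.\<close>

lemma AE_tendsto_0_if_summable_integral:
  fixes Y :: "nat \<Rightarrow> 'a \<Rightarrow> real"
  assumes int: "\<And>n. integrable M (Y n)"
    and nonneg: "\<And>n \<omega>. 0 \<le> Y n \<omega>"
    and summable: "summable (\<lambda>n. integral\<^sup>L M (Y n))"
  shows "AE \<omega> in M. (\<lambda>n. Y n \<omega>) \<longlonglongrightarrow> 0"
proof -
  have [measurable]: "Y n \<in> borel_measurable M" for n
    using int by (rule borel_measurable_integrable)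
  have "(\<integral>\<^sup>+\<omega>. (\<Sum>n. ennreal (Y n \<omega>)) \<partial>M) = (\<Sum>n. ennreal (integral\<^sup>L M (Y n)))"
    by (subst nn_integral_suminf) (simp_all add: nn_integral_eq_integral int nonneg)
  also have "\<dots> \<noteq> \<infinity>"
    by (metis infinity_ennreal_def suminf_ennreal_eq summable_sums ennreal_neq_top
        summable Bochner_Integration.integral_nonneg nonneg)
  finally have "AE \<omega> in M. (\<Sum>n. ennreal (Y n \<omega>)) \<noteq> \<infinity>"
    by (intro nn_integral_PInf_AE) measurable
  then show ?thesis
    by eventually_elim (auto intro!: summable_LIMSEQ_zero summable_suminf_not_top nonneg)
qed

text \<open>The second moment would not do: the sample mean has variance \<sigma>^2/n, which is not
  summable. The factor 3 is 4!/(2^2 * 2!), from the even moment formula with k = 2.\<close>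

lemma (in prob_space) normal_distributed_fourth_moment:
  assumes X: "distributed M lborel X (normal_density \<mu> \<sigma>)" and [arith]: "0 < \<sigma>"
  shows "integrable M (\<lambda>\<omega>. (X \<omega> - \<mu>) ^ 4)"
    and "expectation (\<lambda>\<omega>. (X \<omega> - \<mu>) ^ 4) = 3 * \<sigma> ^ 4"
proof -
  show "integrable M (\<lambda>\<omega>. (X \<omega> - \<mu>) ^ 4)"
    using distributed_integrable[OF X, of "\<lambda>x. (x - \<mu>) ^ 4"] integrable_normal_moment[of \<sigma> \<mu> 4]
    by simp
  have "expectation (\<lambda>\<omega>. (X \<omega> - \<mu>) ^ 4) = (\<integral>x. normal_density \<mu> \<sigma> x * (x - \<mu>) ^ (2 * 2) \<partial>lborel)"
    using distributed_integral[OF X, of "\<lambda>x. (x - \<mu>) ^ 4"] by simp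
  also have "\<dots> = 3 * \<sigma> ^ 4"
    by (subst integral_normal_moment_even) (simp_all add: fact_numeral field_simps flip: power_mult)
  finally show "expectation (\<lambda>\<omega>. (X \<omega> - \<mu>) ^ 4) = 3 * \<sigma> ^ 4" .
qed

lemma (in prob_space) strong_law_normal:
  fixes X :: "nat \<Rightarrow> 'a \<Rightarrow> real"
  assumes indep: "indep_vars (\<lambda>_. borel) X UNIV"
    and normal: "\<And>k. distributed M lborel (X k) (normal_density \<mu> \<sigma>)"
    and [arith]: "0 < \<sigma>"
  shows "AE \<omega> in M. (\<lambda>n. (\<Sum>k<n. X k \<omega>) / real n) \<longlonglongrightarrow> \<mu>"
proof -
  \<comment> \<open>The shift to \<open>Suc n\<close> leaves out the empty mean, so that the
    standard deviation \<sigma> / sqrt (n + 1) is positive for every index.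
    \<open>LIMSEQ_imp_Suc\<close> undoes the shift at the end.\<close>
  define A where "A n \<omega> = (\<Sum>k<Suc n. X k \<omega>) / real (Suc n)" for n \<omega>
  have dist: "distributed M lborel (A n) (normal_density \<mu> (\<sigma> / sqrt (real (Suc n))))" for n
  proof -
    have "distributed M lborel (\<lambda>\<omega>. \<Sum>k<Suc n. X k \<omega>)
        (normal_density (\<Sum>k<Suc n. \<mu>) (sqrt (\<Sum>k<Suc n. \<sigma>\<^sup>2)))"
      by (intro sum_indep_normal indep_vars_subset[OF indep] normal) auto
    then have S: "distributed M lborel (\<lambda>\<omega>. \<Sum>k<Suc n. X k \<omega>)
        (normal_density (real (Suc n) * \<mu>) (sqrt (real (Suc n)) * \<sigma>))"
      by (simp only: sum_constant card_lessThan real_sqrt_mult real_sqrt_abs) simp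
    have "\<bar>1 / real (Suc n)\<bar> * (sqrt (real (Suc n)) * \<sigma>) = \<sigma> / sqrt (real (Suc n))"
      by (simp add: divide_simps del: of_nat_Suc)
    with normal_density_affine[OF S, of "1 / real (Suc n)" 0] show ?thesis
      by (simp add: A_def[abs_def] del: of_nat_Suc sum.lessThan_Suc)
  qed
  have "AE \<omega> in M. (\<lambda>n. (A n \<omega> - \<mu>) ^ 4) \<longlonglongrightarrow> 0"
  proof (rule AE_tendsto_0_if_summable_integral)
    have "expectation (\<lambda>\<omega>. (A n \<omega> - \<mu>) ^ 4) = 3 * \<sigma> ^ 4 * (1 / real (Suc n) ^ 2)" for n
    proof -
      have "sqrt (real (Suc n)) ^ 4 = (sqrt (real (Suc n)) ^ 2) ^ 2"
        using power_mult[of "sqrt (real (Suc n))" 2 2] by simp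
      then have "sqrt (real (Suc n)) ^ 4 = real (Suc n) ^ 2"
        by simp
      then show ?thesis
        by (subst normal_distributed_fourth_moment[OF dist]) (simp_all add: power_divide)
    qed
    moreover have "summable (\<lambda>n. 3 * \<sigma> ^ 4 * (1 / real (Suc n) ^ 2))"
      using inverse_power_summable[of 2, where 'a = real]
      by (intro summable_mult) (simp add: summable_Suc_iff[of "\<lambda>n. inverse (real n ^ 2)"]
          divide_inverse del: of_nat_Suc)
    ultimately show "summable (\<lambda>n. expectation (\<lambda>\<omega>. (A n \<omega> - \<mu>) ^ 4))"
      by simp
  qed (auto intro!: normal_distributed_fourth_moment[OF dist])
  then show ?thesis
  proof eventually_elim
    case (elim \<omega>)
    have "(\<lambda>n. A n \<omega> - \<mu>) \<longlonglongrightarrow> 0"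
    proof -
      \<comment> \<open>The fourth root is continuous at 0 and turns the fourth power of the
        deviation back into its absolute value.\<close>
      have "(\<lambda>n. root 4 \<bar>(A n \<omega> - \<mu>) ^ 4\<bar>) \<longlonglongrightarrow> root 4 \<bar>0\<bar>"
        by (intro tendsto_intros elim)
      then show ?thesis
        using real_root_power_cancel[of 4 "\<bar>A n \<omega> - \<mu>\<bar>" for n]
        by (simp add: power_even_abs tendsto_rabs_zero_iff)
    qed
    then have "(\<lambda>n. A n \<omega>) \<longlonglongrightarrow> \<mu>"
      by (rule LIM_zero_cancel)
    then show ?case
      unfolding A_def by (rule LIMSEQ_imp_Suc)
  qed
qed

lemma strong_law_PiM_normal:
  assumes [arith]: "0 < \<sigma>"
  shows "AE z in (\<Pi>\<^sub>M k\<in>(UNIV :: nat set). density lborel (\<lambda>x. ennreal (normal_density \<mu> \<sigma> x))).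
           (\<lambda>n. (\<Sum>k<n. z k) / real n) \<longlonglongrightarrow> \<mu>"
proof -
  define N where "N = density lborel (\<lambda>x. ennreal (normal_density \<mu> \<sigma> x))"
  interpret N: prob_space N
    unfolding N_def by (rule prob_space_normal_density) simp
  have sets_N [measurable_cong]: "sets N = sets borel"
    by (simp add: N_def)
  let ?P = "\<Pi>\<^sub>M k\<in>(UNIV :: nat set). N"
  interpret P: prob_space ?P
    by (rule prob_space_PiM) (rule N.prob_space_axioms)
  have distr: "distr ?P borel (\<lambda>z. z k) = N" for k
    using distr_PiM_component[of UNIV "\<lambda>_. N" k] N.prob_space_axioms
    by (simp cong: distr_cong add: distr_cong[OF refl sets_N])
  \<comment> \<open>Independence means that the joint law is the product of the marginals. The joint
    map of all coordinates is the identity and each marginal is \<open>N\<close>, so both sides are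
    \<open>?P\<close>.\<close>
  have "P.indep_vars (\<lambda>_. borel) (\<lambda>k z. z k) UNIV"
  proof (subst P.indep_vars_iff_distr_eq_PiM)
    have "distr ?P (\<Pi>\<^sub>M k\<in>UNIV. borel) (\<lambda>z. z) = ?P"
      by (rule distr_id2) (intro sets_PiM_cong refl sets_N[symmetric])
    then show "distr ?P (\<Pi>\<^sub>M k\<in>UNIV. borel) (\<lambda>z. \<lambda>k\<in>UNIV. z k) =
        (\<Pi>\<^sub>M k\<in>UNIV. distr ?P borel (\<lambda>z. z k))"
      by (simp add: distr restrict_UNIV)
  qed auto
  \<comment> \<open>\<open>distributed\<close> refers to \<open>lborel\<close> where
    \<open>distr\<close> used \<open>borel\<close>; a push-forward depends only on the sets of its
    target, and these agree.\<close>
  moreover have "distributed ?P lborel (\<lambda>z. z k) (normal_density \<mu> \<sigma>)" for k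
    using distr[of k] distr_cong[of ?P ?P lborel borel "\<lambda>z. z k" "\<lambda>z. z k"]
    by (simp add: distributed_def N_def[symmetric])
  ultimately have "AE z in ?P. (\<lambda>n. (\<Sum>k<n. z k) / real n) \<longlonglongrightarrow> \<mu>"
    by (rule P.strong_law_normal) simp
  then show ?thesis
    unfolding N_def .
qed

lemma ou_variance_pos:
  assumes "0 < t" "0 < \<sigma>" "0 < \<theta>"
  shows "0 < ou_variance t \<sigma> \<theta>"
  using assms by (simp add: ou_variance_def)

lemma tendsto_rate_estimate:
  assumes "t > 0" "x0 \<noteq> \<mu>" "\<theta> > 0"
    and mean: "(\<lambda>n. (\<Sum>k<n. z k) / real n) \<longlonglongrightarrow> ou_mean t x0 \<mu> \<theta>"
  shows "(\<lambda>n. rate_estimate t x0 \<mu> n (restrict z {..<n})) \<longlonglongrightarrow> \<theta>"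
proof -
  define q where "q n = ((\<Sum>k<n. z k) / real n - \<mu>) / (x0 - \<mu>)" for n
  have "q \<longlonglongrightarrow> (ou_mean t x0 \<mu> \<theta> - \<mu>) / (x0 - \<mu>)"
    unfolding q_def[abs_def] using assms by (intro tendsto_intros mean) auto
  also have "(ou_mean t x0 \<mu> \<theta> - \<mu>) / (x0 - \<mu>) = exp (- \<theta> * t)"
    using assms by (simp add: ou_mean_def field_simps)
  finally have q: "q \<longlonglongrightarrow> exp (- \<theta> * t)" .
  \<comment> \<open>The limit of \<open>q\<close> is an exponential, hence nonzero, so the logarithm
    is continuous there.\<close>
  then have "(\<lambda>n. - (1 / t) * ln (q n)) \<longlonglongrightarrow> - (1 / t) * ln (exp (- \<theta> * t))"
    by (intro tendsto_intros) auto
  then have "(\<lambda>n. - (1 / t) * ln (q n)) \<longlonglongrightarrow> \<theta>"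
    using assms by simp
  \<comment> \<open>As the limit of \<open>q\<close> is positive, the default value 0 of the
    estimate occurs for only finitely many n and does not affect the limit.\<close>
  moreover have "eventually (\<lambda>n. q n > 0) sequentially"
    using q by (rule order_tendstoD) simp
  then have "eventually (\<lambda>n. - (1 / t) * ln (q n) = rate_estimate t x0 \<mu> n (restrict z {..<n}))
      sequentially"
    by eventually_elim (simp add: rate_estimate_def q_def)
  ultimately show ?thesis
    by (rule Lim_transform_eventually)
qed

lemma measurable_rate_estimate [measurable]:
  "rate_estimate t x0 \<mu> n \<in> borel_measurable (borel_Rn n)"
  unfolding rate_estimate_def[abs_def] Let_def by measurable

theorem lemma3p3p1:
  fixes t x0 \<mu> \<sigma> :: real
  assumes "t > 0" and "\<sigma> > 0" and "x0 \<noteq> \<mu>"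
  shows "(\<forall>\<theta>>0. measure (infinite_power (ou_law t x0 \<mu> \<sigma> \<theta>))
            {z. (\<lambda>n. rate_estimate t x0 \<mu> n (restrict z {..<n})) \<longlonglongrightarrow> \<theta>} = 1)
       \<and> consistent_estimator_ae {0<..} (ou_law t x0 \<mu> \<sigma>) (rate_estimate t x0 \<mu>)"
proof -
  have sets_ou: "sets (ou_law t x0 \<mu> \<sigma> \<theta>) = sets borel" for \<theta>
    by (simp add: ou_law_def)
  have prob_ou: "prob_space (ou_law t x0 \<mu> \<sigma> \<theta>)" if "\<theta> > 0" for \<theta>
    unfolding ou_law_def
    by (intro prob_space_normal_density) (simp add: ou_variance_pos assms that)
  have lim: "measure (infinite_power (ou_law t x0 \<mu> \<sigma> \<theta>))
      {z. (\<lambda>n. rate_estimate t x0 \<mu> n (restrict z {..<n})) \<longlonglongrightarrow> \<theta>} = 1" if "\<theta> > 0" for \<theta>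
  proof -
    let ?M = "infinite_power (ou_law t x0 \<mu> \<sigma> \<theta>)"
    have sets_M [measurable_cong]: "sets ?M = sets (\<Pi>\<^sub>M k\<in>(UNIV :: nat set). borel :: real measure)"
      unfolding infinite_power_def by (intro sets_PiM_cong refl sets_ou)
    then have space_M: "space ?M = UNIV"
      by (simp add: sets_eq_imp_space_eq[OF sets_M] space_PiM)
    interpret prob_space ?M
      unfolding infinite_power_def by (intro prob_space_PiM prob_ou that)
    have "AE z in ?M. (\<lambda>n. (\<Sum>k<n. z k) / real n) \<longlonglongrightarrow> ou_mean t x0 \<mu> \<theta>"
      unfolding infinite_power_def ou_law_def
      by (intro strong_law_PiM_normal) (simp add: ou_variance_pos assms that)
    then have "AE z in ?M. (\<lambda>n. rate_estimate t x0 \<mu> n (restrict z {..<n})) \<longlonglongrightarrow> \<theta>"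
      by eventually_elim (intro tendsto_rate_estimate assms that)
    \<comment> \<open>The almost-everywhere statement only puts the complement inside a null set;
      \<open>measure\<close> would be 0 on a non-measurable set, so measurability of the event is
      needed to get probability 1.\<close>
    moreover have "{z \<in> space ?M. (\<lambda>n. rate_estimate t x0 \<mu> n (restrict z {..<n})) \<longlonglongrightarrow> \<theta>} \<in> events"
      by measurable
    ultimately show ?thesis
      using prob_Collect_eq_1 by (simp add: space_M)
  qed
  then show ?thesis
    by (simp add: consistent_estimator_ae_def sets_ou prob_ou)
qed

end
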